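(* Let $1\le\ell\le m$ and let $\alpha=(\alpha_1,\dots,\alpha_\ell)$ with $1\le\alpha_1<\dots<\alpha_\ell\le m$ decompose into $u+1$ consecutive blocks, i.e. there are $1\le p_1<\dots<p_u<\ell$ such that, with $p_0=0$ and $p_{u+1}=\ell$, the entries $\alpha_{p_i+1},\dots,\alpha_{p_{i+1}}$ are consecutive integers for each $0\le i\le u$. Then the length $n_\alpha$ of the Schubert code $C_\alpha(\ell,m)$ (the number of $\mathbb{F}_q$-rational points of $\Omega_\alpha$) is $$n_\alpha=\sum_{s_1=p_1}^{\alpha_{p_1}}\sum_{s_2=p_2}^{\alpha_{p_2}}\cdots\sum_{s_u=p_u}^{\alpha_{p_u}}\ \prod_{i=0}^{u}\lambda(\alpha_{p_i},\alpha_{p_{i+1}};s_i,s_{i+1}),$$ with the conventions $s_0=p_0=0$, $s_{u+1}=p_{u+1}=\ell$, and $\alpha_0=0$.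
   Context: $\mathbb{F}_q$ is the finite field with $q$ elements, $V=\mathbb{F}_q^m$ with standard basis $e_1,\dots,e_m$, $A_j=\mathrm{span}(e_1,\dots,e_j)$ ($A_0=0$). $G_{\ell,m}$ is the Grassmannian of $\ell$-dimensional subspaces of $V$, and $\Omega_\alpha=\{W\in G_{\ell,m}:\dim(W\cap A_{\alpha_i})\ge i,\ i=1,\dots,\ell\}$. The Schubert code $C_\alpha(\ell,m)$ is the linear code associated with the projective system of $\mathbb{F}_q$-rational points of $\Omega_\alpha$ under the Plücker embedding into $\mathbb{P}(\wedge^\ell V)$ (inside the linear span of their images); its length is the number of these points. Gaussian binomial: ${u\brack v}_q=\prod_{i=0}^{v-1}\frac{q^u-q^i}{q^v-q^i}$ if $0\le v\le u$, and $0$ otherwise. For integers $a,b,s,t$, $\lambda(a,b;s,t)=\sum_{r=s}^{t}(-1)^{r-s}q^{\binom{r-s}{2}}{a-s\brack r-s}_q{b-r\brack t-r}_q$. *)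

theory Defs
  imports "Jordan_Normal_Form.Determinant" "HOL-Library.Function_Algebras"
    "HOL-Library.FuncSet" "HOL-Library.Cardinality"
begin

text \<open>
  The field with \<open>q\<close> elements is a type \<open>'a :: {field, finite}\<close>, with \<open>q = CARD('a)\<close>.  Vectors are
  functions on an index type: \<open>nat\<close> for \<open>V\<close> (with support in \<open>{1..m}\<close>, see \<open>ambient\<close>)
  and \<open>nat set\<close> for the exterior power of \<open>V\<close>.
\<close>

definition fscale :: "'a::field \<Rightarrow> ('i \<Rightarrow> 'a) \<Rightarrow> ('i \<Rightarrow> 'a)" where
  "fscale c v = (\<lambda>i. c * v i)"

interpretation fn: vector_space "fscale :: 'a::field \<Rightarrow> ('i \<Rightarrow> 'a) \<Rightarrow> ('i \<Rightarrow> 'a)"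
  by unfold_locales (auto simp: fscale_def fun_eq_iff algebra_simps)

definition ambient :: "nat \<Rightarrow> (nat \<Rightarrow> 'a::field) set" where
  "ambient m = {v. \<forall>i. i \<notin> {1..m} \<longrightarrow> v i = 0}"

definition std_basis :: "nat \<Rightarrow> (nat \<Rightarrow> 'a::field)" where
  "std_basis i = (\<lambda>j. if j = i then 1 else 0)"

definition flag :: "nat \<Rightarrow> (nat \<Rightarrow> 'a::field) set" where
  "flag j = fn.span (std_basis ` {1..j})"

definition grassmannian :: "nat \<Rightarrow> nat \<Rightarrow> (nat \<Rightarrow> 'a::field) set set" where
  "grassmannian l m = {W. fn.subspace W \<and> W \<subseteq> ambient m \<and> fn.dim W = l}"

definition schubert_variety ::
    "nat \<Rightarrow> nat \<Rightarrow> (nat \<Rightarrow> nat) \<Rightarrow> (nat \<Rightarrow> 'a::field) set set" where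
  "schubert_variety l m \<alpha> =
     {W \<in> grassmannian l m. \<forall>i\<in>{1..l}. i \<le> fn.dim (W \<inter> flag (\<alpha> i))}"

text \<open>
  The exterior power is given by its coordinates with respect to the basis
  \<open>e_I = e_{i_1} \<and> \<dots> \<and> e_{i_l}\<close>, where \<open>I = {i_1 < \<dots> < i_l}\<close> is contained in \<open>{1..m}\<close>.
  The \<open>I\<close>-th coordinate of \<open>w_1 \<and> \<dots> \<and> w_l\<close> is the minor on the columns in \<open>I\<close>.
\<close>

definition wedge :: "nat \<Rightarrow> (nat \<Rightarrow> 'a::field) list \<Rightarrow> (nat set \<Rightarrow> 'a)" where
  "wedge m ws = (\<lambda>I. if I \<subseteq> {1..m} \<and> card I = length ws
     then det (mat (length ws) (length ws) (\<lambda>(i, j). (ws ! i) (sorted_list_of_set I ! j)))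
     else 0)"

text \<open>
  A point of a projective space is a line through the origin.  The Pluecker image of
  \<open>W\<close> is the line spanned by \<open>w_1 \<and> \<dots> \<and> w_l\<close> for a basis of \<open>W\<close>.  Tuples in \<open>W\<close> that
  are not bases have wedge product zero, and different bases give proportional products,
  so no basis has to be chosen.
\<close>

definition pluecker :: "nat \<Rightarrow> nat \<Rightarrow> (nat \<Rightarrow> 'a::field) set \<Rightarrow> (nat set \<Rightarrow> 'a) set" where
  "pluecker l m W = fn.span {wedge m ws | ws. length ws = l \<and> set ws \<subseteq> W}"

definition linear_form_on :: "('i \<Rightarrow> 'a::field) set \<Rightarrow> (('i \<Rightarrow> 'a) \<Rightarrow> 'a) \<Rightarrow> bool" where
  "linear_form_on U f \<longleftrightarrow>
     (\<forall>x\<in>U. \<forall>y\<in>U. f (x + y) = f x + f y) \<and> (\<forall>c. \<forall>x\<in>U. f (fscale c x) = c * f x)"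

text \<open>
  The code of a projective system \<open>X\<close> (a finite set of projective points) evaluates the linear
  forms on the linear span of \<open>X\<close> at representatives of the points of \<open>X\<close>.  It depends
  on the ordering of the points and on the representatives only up to (monomial) equivalence;
  \<open>is_code_of X C\<close> admits every such choice.
\<close>

definition is_code_of :: "('i \<Rightarrow> 'a::field) set set \<Rightarrow> 'a list set \<Rightarrow> bool" where
  "is_code_of X C \<longleftrightarrow> (\<exists>xs. distinct (map (\<lambda>x. fn.span {x}) xs) \<and>
     set (map (\<lambda>x. fn.span {x}) xs) = X \<and>
     C = {map f xs | f. linear_form_on (fn.span (set xs)) f})"

definition code_length :: "'a list set \<Rightarrow> nat" where
  "code_length C = (THE n. \<forall>w\<in>C. length w = n)"

definition is_schubert_code :: "nat \<Rightarrow> nat \<Rightarrow> (nat \<Rightarrow> nat) \<Rightarrow> 'a::field list set \<Rightarrow> bool" where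
  "is_schubert_code l m \<alpha> C \<longleftrightarrow> is_code_of (pluecker l m ` schubert_variety l m \<alpha>) C"

definition gauss_binomial :: "nat \<Rightarrow> int \<Rightarrow> int \<Rightarrow> rat" where
  "gauss_binomial q u v =
     (if 0 \<le> v \<and> v \<le> u
      then \<Prod>i<nat v. (of_nat q ^ nat u - of_nat q ^ i) / (of_nat q ^ nat v - of_nat q ^ i)
      else 0)"

definition schubert_lambda :: "nat \<Rightarrow> int \<Rightarrow> int \<Rightarrow> int \<Rightarrow> int \<Rightarrow> rat" where
  "schubert_lambda q a b s t =
     (\<Sum>r=s..t. (-1) ^ nat (r - s) * of_nat q ^ (nat (r - s) choose 2) *
        gauss_binomial q (a - s) (r - s) * gauss_binomial q (b - r) (t - r))"

end

theory Submission
  imports Defs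
begin

text \<open>
  The length of the code is the number of distinct lines in the Pluecker image.  The embedding is
  injective: if \<open>W\<close> and \<open>W'\<close> have the same line and \<open>v \<in> W'\<close>, then \<open>v \<and> x = 0\<close> for all \<open>x\<close> in the line of \<open>W'\<close>, and
  \<open>v \<and> w_1 \<and> \<dots> \<and> w_l = 0\<close> for a basis of \<open>W\<close> forces \<open>v\<close> into \<open>W\<close>.

  For the count, passing from \<open>A_(j+1)\<close> to \<open>A_j\<close> lowers the dimension of the intersection
  with \<open>W\<close> by at most one, so only the Schubert conditions at the ends \<open>p_i\<close> of the blocks matter.
  Stratify by \<open>s_i = dim (W \<inter> A_(\<alpha> p_i))\<close> and build \<open>W\<close> up along the chain of these
  intersections.  The number of extensions of \<open>S \<subseteq> A\<close> to a \<open>t\<close>-dimensional \<open>W \<subseteq> B\<close> with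
  \<open>W \<inter> A = S\<close> depends only on dimensions and equals \<open>\<lambda>\<close> by Moebius inversion over the
  subspaces between \<open>S\<close> and \<open>A\<close>.
\<close>

section \<open>Counting subspaces over a finite field\<close>

text \<open>The type \<open>'b\<close> may be infinite, as it is for vectors indexed by
  \<open>nat\<close>; this is why finiteness of the subspaces appears as a separate hypothesis in
  the counting.\<close>

locale finite_field_vector_space = vector_space scale
  for scale :: "'a::{field,finite} \<Rightarrow> 'b::ab_group_add \<Rightarrow> 'b" (infixr "*s" 75)
begin

text \<open>The map from \<open>(c, x)\<close> to \<open>c *s v + x\<close> is a bijection of the
  field times \<open>span S\<close> onto the new span; two preimages with different scalars would
  put \<open>v\<close> into \<open>span S\<close>.\<close>

lemma card_span_insert:
  assumes "finite (span S)" and "v \<notin> span S"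
  shows "finite (span (insert v S))" and "card (span (insert v S)) = CARD('a) * card (span S)"
proof -
  define f where "f = (\<lambda>(c, x). c *s v + x)"
  have "inj_on f (UNIV \<times> span S)"
  proof (rule inj_onI)
    fix y z assume y: "y \<in> UNIV \<times> span S" and z: "z \<in> UNIV \<times> span S" and eq: "f y = f z"
    obtain c x d w where yz: "y = (c, x)" "z = (d, w)" by (cases y, cases z)
    then have xw: "x \<in> span S" "w \<in> span S" and e: "c *s v + x = d *s v + w"
      using y z eq by (auto simp: f_def)
    have "(c - d) *s v = w - x" using e by (simp add: scale_left_diff_distrib algebra_simps)
    then have vv: "(c - d) *s v \<in> span S" using xw by (simp add: span_diff)
    have "c = d"
    proof (rule ccontr)
      assume "c \<noteq> d"
      have "inverse (c - d) *s ((c - d) *s v) \<in> span S" using vv by (rule span_scale)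
      then show False using \<open>c \<noteq> d\<close> assms(2) by simp
    qed
    then show "y = z" using e yz by simp
  qed
  moreover have "f ` (UNIV \<times> span S) = span (insert v S)"
  proof (intro equalityI subsetI)
    fix y assume "y \<in> f ` (UNIV \<times> span S)"
    then obtain c x where x: "x \<in> span S" "y = c *s v + x" by (auto simp: f_def)
    then have "y - c *s v \<in> span S" by simp
    then show "y \<in> span (insert v S)" unfolding span_insert by blast
  next
    fix y assume "y \<in> span (insert v S)"
    then obtain c where "y - c *s v \<in> span S" unfolding span_insert by blast
    then have "y = f (c, y - c *s v)" "(c, y - c *s v) \<in> UNIV \<times> span S" by (auto simp: f_def)
    then show "y \<in> f ` (UNIV \<times> span S)" by blast
  qed
  ultimately have "bij_betw f (UNIV \<times> span S) (span (insert v S))" by (simp add: bij_betw_def)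
  note bij = this
  show "finite (span (insert v S))" using bij_betw_finite[OF bij] assms(1) by simp
  show "card (span (insert v S)) = CARD('a) * card (span S)"
    using bij_betw_same_card[OF bij] by (simp add: card_cartesian_product)
qed

lemma finite_span: "finite B \<Longrightarrow> finite (span B)"
proof (induction B rule: finite_induct)
  case (insert x F)
  then show ?case
    using card_span_insert(1)[of F x] span_redundant[of x F] by (cases "x \<in> span F") auto
qed simp

lemma card_span_independent:
  "finite B \<Longrightarrow> independent B \<Longrightarrow> card (span B) = CARD('a) ^ card B"
proof (induction B rule: finite_induct)
  case (insert x F)
  then show ?case using card_span_insert(2)[of F x] finite_span[of F]
    by (simp add: independent_insert)
qed simp

text \<open>Dimension is thus the logarithm of the cardinality to base \<open>CARD('a)\<close>; the
  dimension criteria that follow are read off from cardinalities.\<close>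

lemma card_subspace:
  assumes "subspace W" and "finite W"
  shows "card W = CARD('a) ^ dim W"
proof -
  obtain B where B: "B \<subseteq> W" "independent B" "W \<subseteq> span B" "card B = dim W"
    using basis_exists by blast
  then have "span B = W" using assms(1) by (simp add: span_subspace)
  then show ?thesis using card_span_independent[of B] B assms(2) finite_subset by metis
qed

lemma card_field_ge_2: "2 \<le> CARD('a)"
proof -
  have "card {0, 1 :: 'a} \<le> CARD('a)" by (rule card_mono) auto
  then show ?thesis by simp
qed

lemma dim_eqI:
  assumes "subspace W" and "finite W" and "card W = CARD('a) ^ n"
  shows "dim W = n"
  using card_subspace[OF assms(1,2)] assms(3) card_field_ge_2 by (simp add: power_inject_exp)

lemma dim_mono_finite:
  assumes "subspace V" and "subspace W" and "finite W" and "V \<subseteq> W"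
  shows "dim V \<le> dim W"
proof -
  have "card V \<le> card W" using assms by (simp add: card_mono)
  then show ?thesis
    using assms card_field_ge_2 finite_subset[OF assms(4,3)]
    by (simp add: card_subspace power_le_imp_le_exp)
qed

lemma subspace_eq_if_dim_le:
  assumes "subspace V" and "subspace W" and "finite W" and "V \<subseteq> W" and "dim W \<le> dim V"
  shows "V = W"
proof -
  have "dim V = dim W" using dim_mono_finite assms by (simp add: le_antisym)
  then have "card V = card W" using assms finite_subset[OF assms(4,3)] by (simp add: card_subspace)
  then show ?thesis using assms by (simp add: card_subset_eq)
qed

lemma dim_span_insert:
  assumes "finite (span S)" and "v \<notin> span S"
  shows "dim (span (insert v S)) = Suc (dim (span S))"
  by (rule dim_eqI) (use assms card_span_insert[OF assms] card_subspace[of "span S"] in auto)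

text \<open>Since \<open>k\<close> vectors raise the dimension by at most \<open>k\<close>, the
  equation says that the entries are linearly independent modulo \<open>S\<close>. The tuples serve
  to count subspaces by double counting.\<close>

definition extension_tuples :: "'b set \<Rightarrow> 'b set \<Rightarrow> nat \<Rightarrow> 'b list set" where
  "extension_tuples S B k =
     {vs. length vs = k \<and> set vs \<subseteq> B \<and> dim (span (S \<union> set vs)) = dim S + k}"

lemma dim_span_Un_le:
  assumes "finite (span S)"
  shows "finite (span (S \<union> set vs)) \<and> dim (span (S \<union> set vs)) \<le> dim S + length vs"
proof (induction vs)
  case Nil
  then show ?case using assms by simp
next
  case (Cons v vs)
  show ?case
  proof (cases "v \<in> span (S \<union> set vs)")
    case True
    then have "span (S \<union> set (v # vs)) = span (S \<union> set vs)"
      using span_redundant[of v "S \<union> set vs"] by simp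
    then show ?thesis using Cons by simp
  next
    case False
    then show ?thesis using Cons dim_span_insert[of "S \<union> set vs" v] card_span_insert(1)[of "S \<union> set vs" v]
      by simp
  qed
qed

text \<open>As \<open>dim S + Suc k\<close> is the largest possible dimension, the tail must already
  reach \<open>dim S + k\<close> and the head must leave the span of \<open>S\<close> and the
  tail.\<close>

lemma extension_tuples_Suc:
  assumes "finite (span S)"
  shows "extension_tuples S B (Suc k) =
    (\<Union>vs\<in>extension_tuples S B k. (\<lambda>v. v # vs) ` (B - span (S \<union> set vs)))" (is "_ = ?R")
proof (intro equalityI subsetI)
  fix ws assume ws: "ws \<in> extension_tuples S B (Suc k)"
  then obtain v vs where vvs: "ws = v # vs" by (cases ws) (auto simp: extension_tuples_def)
  have fin: "finite (span (S \<union> set vs))" and le: "dim (span (S \<union> set vs)) \<le> dim S + k"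
    using dim_span_Un_le[OF assms, of vs] ws vvs by (auto simp: extension_tuples_def)
  have d: "dim (span (insert v (S \<union> set vs))) = Suc (dim S + k)"
    using ws vvs by (simp add: extension_tuples_def)
  have nin: "v \<notin> span (S \<union> set vs)"
  proof
    assume "v \<in> span (S \<union> set vs)"
    then show False using d le span_redundant by fastforce
  qed
  then have "dim (span (S \<union> set vs)) = dim S + k" using dim_span_insert[OF fin nin] d by simp
  then show "ws \<in> ?R" using ws vvs nin by (auto simp: extension_tuples_def)
next
  fix ws assume "ws \<in> ?R"
  then obtain v vs where *: "ws = v # vs" "vs \<in> extension_tuples S B k" "v \<in> B"
    "v \<notin> span (S \<union> set vs)" by auto
  have fin: "finite (span (S \<union> set vs))" using dim_span_Un_le[OF assms] by blast
  show "ws \<in> extension_tuples S B (Suc k)"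
    using * dim_span_insert[OF fin *(4)] by (auto simp: extension_tuples_def)
qed

text \<open>A head added to a tuple of length \<open>i\<close> avoids a subspace of dimension
  \<open>dim S + i\<close>, which gives the \<open>i\<close>-th factor. If \<open>k\<close> exceeds
  \<open>dim B - dim S\<close>, the factor with \<open>dim S + i = dim B\<close> makes the product
  0.\<close>

lemma card_extension_tuples:
  assumes S: "subspace S" and B: "subspace B" "finite B" and SB: "S \<subseteq> B"
  shows "finite (extension_tuples S B k)"
    and "card (extension_tuples S B k) = (\<Prod>i<k. CARD('a) ^ dim B - CARD('a) ^ (dim S + i))"
proof -
  have finS: "finite (span S)" using S B SB finite_subset by (metis span_eq_iff)
  have "finite (extension_tuples S B k) \<and>
    card (extension_tuples S B k) = (\<Prod>i<k. CARD('a) ^ dim B - CARD('a) ^ (dim S + i))"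
  proof (induction k)
    case 0
    have "extension_tuples S B 0 = {[]}" by (auto simp: extension_tuples_def)
    then show ?case by simp
  next
    case (Suc k)
    let ?F = "\<lambda>vs. (\<lambda>v. v # vs) ` (B - span (S \<union> set vs))"
    have c: "card (?F vs) = CARD('a) ^ dim B - CARD('a) ^ (dim S + k)"
      if vs: "vs \<in> extension_tuples S B k" for vs
    proof -
      have sub: "span (S \<union> set vs) \<subseteq> B"
        using vs SB B by (intro span_minimal) (auto simp: extension_tuples_def)
      have "card (?F vs) = card (B - span (S \<union> set vs))" by (rule card_image) (auto intro: inj_onI)
      also have "\<dots> = card B - card (span (S \<union> set vs))"
        using sub B finite_subset by (intro card_Diff_subset) auto
      also have "\<dots> = CARD('a) ^ dim B - CARD('a) ^ (dim S + k)"
        using card_subspace[OF B] card_subspace[of "span (S \<union> set vs)"] finite_subset[OF sub B(2)] vs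
        by (simp add: extension_tuples_def del: dim_span)
      finally show ?thesis .
    qed
    have "card (extension_tuples S B (Suc k)) = (\<Sum>vs\<in>extension_tuples S B k. card (?F vs))"
      unfolding extension_tuples_Suc[OF finS] using Suc B(2) by (intro card_UN_disjoint) auto
    also have "\<dots> = card (extension_tuples S B k) * (CARD('a) ^ dim B - CARD('a) ^ (dim S + k))"
      using c by simp
    finally show ?case using Suc B(2) by (simp add: extension_tuples_Suc[OF finS] mult.commute)
  qed
  then show "finite (extension_tuples S B k)"
    and "card (extension_tuples S B k) = (\<Prod>i<k. CARD('a) ^ dim B - CARD('a) ^ (dim S + i))" by auto
qed

text \<open>A tuple in \<open>B\<close> is assigned to the subspace that it spans together with
  \<open>S\<close>; sorting by this subspace prepares the double count.\<close>

lemma extension_tuples_partition: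
  assumes S: "subspace S" and B: "subspace B" "finite B" and SB: "S \<subseteq> B"
  shows "extension_tuples S B k =
    (\<Union>U\<in>{U. subspace U \<and> S \<subseteq> U \<and> U \<subseteq> B \<and> dim U = dim S + k}. extension_tuples S U k)"
proof (intro equalityI subsetI)
  fix vs assume vs: "vs \<in> extension_tuples S B k"
  have "span (S \<union> set vs) \<subseteq> B"
    using vs SB B by (intro span_minimal) (auto simp: extension_tuples_def)
  moreover have "S \<subseteq> span (S \<union> set vs)" "set vs \<subseteq> span (S \<union> set vs)" using span_superset by blast+
  ultimately show "vs \<in> (\<Union>U\<in>{U. subspace U \<and> S \<subseteq> U \<and> U \<subseteq> B \<and> dim U = dim S + k}. extension_tuples S U k)"
    using vs by (intro UN_I[of "span (S \<union> set vs)"]) (auto simp: extension_tuples_def simp del: dim_span)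
qed (auto simp: extension_tuples_def)

lemma span_extension_tuple:
  assumes "subspace U" "finite U" "S \<subseteq> U" "dim U = dim S + k" "vs \<in> extension_tuples S U k"
  shows "span (S \<union> set vs) = U"
  by (rule subspace_eq_if_dim_le) (use assms in \<open>auto simp: extension_tuples_def span_minimal
    simp del: dim_span intro!: span_minimal[THEN subsetD]\<close>)

text \<open>Double count of \<open>extension_tuples S B k\<close>: directly, and by the subspace
  \<open>U\<close> spanned, each \<open>U\<close> contributing the same number of tuples. The
  product form avoids division in \<open>nat\<close>.\<close>

lemma card_between_mult:
  assumes S: "subspace S" and B: "subspace B" "finite B" and SB: "S \<subseteq> B"
  shows "card {U. subspace U \<and> S \<subseteq> U \<and> U \<subseteq> B \<and> dim U = dim S + k}
      * (\<Prod>i<k. CARD('a) ^ (dim S + k) - CARD('a) ^ (dim S + i))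
    = (\<Prod>i<k. CARD('a) ^ dim B - CARD('a) ^ (dim S + i))"
proof -
  let ?X = "{U. subspace U \<and> S \<subseteq> U \<and> U \<subseteq> B \<and> dim U = dim S + k}"
  have finX: "finite ?X" by (rule finite_subset[of _ "Pow B"]) (use B in auto)
  have "card (extension_tuples S B k) = (\<Sum>U\<in>?X. card (extension_tuples S U k))"
    unfolding extension_tuples_partition[OF assms]
  proof (rule card_UN_disjoint[OF finX])
    show "\<forall>U\<in>?X. finite (extension_tuples S U k)"
      using S B card_extension_tuples(1) finite_subset by blast
    show "\<forall>U\<in>?X. \<forall>U'\<in>?X. U \<noteq> U' \<longrightarrow> extension_tuples S U k \<inter> extension_tuples S U' k = {}"
    proof (intro ballI impI equals0I)
      fix U U' vs assume U: "U \<in> ?X" "U' \<in> ?X" "U \<noteq> U'" "vs \<in> extension_tuples S U k \<inter> extension_tuples S U' k"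
      then have "finite U" "finite U'" using B finite_subset by blast+
      then show False using U span_extension_tuple[of U S k vs] span_extension_tuple[of U' S k vs] by auto
    qed
  qed
  also have "\<dots> = (\<Sum>U\<in>?X. (\<Prod>i<k. CARD('a) ^ (dim S + k) - CARD('a) ^ (dim S + i)))"
  proof (rule sum.cong[OF refl])
    fix U assume U: "U \<in> ?X"
    then have "finite U" using B finite_subset by blast
    then show "card (extension_tuples S U k) = (\<Prod>i<k. CARD('a) ^ (dim S + k) - CARD('a) ^ (dim S + i))"
      using card_extension_tuples(2)[OF S, of U k] U by simp
  qed
  also have "\<dots> = card ?X * (\<Prod>i<k. CARD('a) ^ (dim S + k) - CARD('a) ^ (dim S + i))" by simp
  finally show ?thesis using card_extension_tuples(2)[OF assms] by simp
qed

end

section \<open>Gaussian binomials\<close>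

text \<open>For \<open>k > n\<close> the numerator with \<open>i = n\<close> vanishes, so the
  product formula also covers the zero case of the definition.\<close>

lemma gauss_binomial_of_nat:
  "gauss_binomial q (int n) (int k) =
    (\<Prod>i<k. (of_nat q ^ n - of_nat q ^ i) / (of_nat q ^ k - of_nat q ^ i))"
proof (cases "k \<le> n")
  case False
  then have "(\<Prod>i<k. (of_nat q ^ n - of_nat q ^ i) / (of_nat q ^ k - of_nat q ^ i)) = (0 :: rat)"
    by (intro prod_zero) (auto intro: bexI[of _ n])
  then show ?thesis using False by (simp add: gauss_binomial_def)
qed (simp add: gauss_binomial_def)

lemma gauss_binomial_0_right [simp]: "gauss_binomial q (int n) 0 = 1"
  using gauss_binomial_of_nat[of q n 0] by simp

lemma power_diff_prod_ne_0:
  assumes "2 \<le> q"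
  shows "(\<Prod>i<k. of_nat q ^ (d + k) - of_nat q ^ (d + i)) \<noteq> (0 :: rat)"
proof -
  have "q ^ (d + k) \<noteq> q ^ (d + i)" if "i < k" for i using assms that by (simp add: power_inject_exp)
  then have "of_nat q ^ (d + k) \<noteq> (of_nat q ^ (d + i) :: rat)" if "i < k" for i
    using that of_nat_eq_iff[where 'a = rat, of "q ^ (d + k)" "q ^ (d + i)"] by simp
  then show ?thesis by simp
qed

text \<open>Removes the common factor \<open>x ^ d\<close>, which in the counts is the contribution
  of \<open>dim S\<close>; what is left depends on differences of dimensions only.\<close>

lemma power_diff_prod_shift:
  fixes x :: "'a::comm_ring_1"
  shows "(\<Prod>i<k. x ^ (d + n) - x ^ (d + i)) = (x ^ d) ^ k * (\<Prod>i<k. x ^ n - x ^ i)"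
proof -
  have "(\<Prod>i<k. x ^ (d + n) - x ^ (d + i)) = (\<Prod>i<k. x ^ d * (x ^ n - x ^ i))"
    by (simp add: power_add algebra_simps)
  then show ?thesis by (simp only: prod.distrib prod_constant card_lessThan)
qed

lemma power_diff_prod_Suc:
  fixes x :: "'a::comm_ring_1"
  shows "(\<Prod>i<Suc k. x ^ Suc n - x ^ i) = (x ^ Suc n - 1) * (x ^ k * (\<Prod>i<k. x ^ n - x ^ i))"
  using power_diff_prod_shift[of x 1 n k] by (subst prod.lessThan_Suc_shift) simp

text \<open>This and the next identity raise one or both arguments by one. Denominators are cleared,
  so that Pascal's rule can be checked by ring arithmetic.\<close>

lemma gauss_binomial_Suc_right:
  assumes "2 \<le> q"
  shows "gauss_binomial q (int n) (int (Suc k)) * (of_nat q ^ Suc k - 1) * of_nat q ^ k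
    = gauss_binomial q (int n) (int k) * (of_nat q ^ n - of_nat q ^ k)"
proof -
  let ?q = "of_nat q :: rat"
  have ne: "(\<Prod>i<k. ?q ^ k - ?q ^ i) \<noteq> 0" "(\<Prod>i<Suc k. ?q ^ Suc k - ?q ^ i) \<noteq> 0"
    by (rule power_diff_prod_ne_0[OF assms, where d = 0, unfolded add_0])+
  show ?thesis
    using ne unfolding gauss_binomial_of_nat prod_dividef power_diff_prod_Suc
    by (simp add: field_simps)
qed

lemma gauss_binomial_Suc_Suc_mult:
  assumes "2 \<le> q"
  shows "gauss_binomial q (int (Suc n)) (int (Suc k)) * (of_nat q ^ Suc k - 1)
    = gauss_binomial q (int n) (int k) * (of_nat q ^ Suc n - 1)"
proof -
  let ?q = "of_nat q :: rat"
  have ne: "(\<Prod>i<k. ?q ^ k - ?q ^ i) \<noteq> 0" "(\<Prod>i<Suc k. ?q ^ Suc k - ?q ^ i) \<noteq> 0"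
    by (rule power_diff_prod_ne_0[OF assms, where d = 0, unfolded add_0])+
  show ?thesis
    using ne unfolding gauss_binomial_of_nat prod_dividef power_diff_prod_Suc
    by (simp add: field_simps)
qed

text \<open>After multiplication by \<open>q ^ Suc k - 1\<close>, the split
  \<open>q ^ Suc n - 1 = (q ^ Suc k - 1) + q * (q ^ n - q ^ k)\<close> produces the two
  summands.\<close>

lemma gauss_binomial_Pascal:
  assumes "2 \<le> q"
  shows "gauss_binomial q (int (Suc n)) (int (Suc k))
    = gauss_binomial q (int n) (int k) + of_nat q ^ Suc k * gauss_binomial q (int n) (int (Suc k))"
proof -
  let ?q = "of_nat q :: rat"
  let ?g = "\<lambda>n k. gauss_binomial q (int n) (int k)"
  have nz: "?q ^ Suc k - 1 \<noteq> 0"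
    using assms one_less_power[of ?q "Suc k"] by simp
  have "?g (Suc n) (Suc k) * (?q ^ Suc k - 1) = ?g n k * (?q ^ Suc n - 1)"
    by (rule gauss_binomial_Suc_Suc_mult[OF assms])
  also have "\<dots> = ?g n k * (?q ^ Suc k - 1) + ?q * (?g n k * (?q ^ n - ?q ^ k))"
    by (simp add: algebra_simps)
  also have "\<dots> = (?g n k + ?q ^ Suc k * ?g n (Suc k)) * (?q ^ Suc k - 1)"
    unfolding gauss_binomial_Suc_right[OF assms, symmetric] by (simp add: algebra_simps)
  finally show ?thesis using nz by simp
qed

text \<open>The closed form of the truncated sum makes an induction on \<open>N\<close> possible:
  Pascal's rule splits the new term into one part that cancels the old value and one that is the new
  value.\<close>

lemma gauss_binomial_alternating_partial_sum:
  assumes "2 \<le> q"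
  shows "(\<Sum>j\<le>N. (-1) ^ j * of_nat q ^ (j choose 2) * gauss_binomial q (int (Suc n)) (int j))
    = (-1) ^ N * of_nat q ^ (Suc N choose 2) * gauss_binomial q (int n) (int N)"
proof (induction N)
  case (Suc N)
  have e: "Suc (Suc N) choose 2 = (Suc N choose 2) + Suc N" for N
    by (simp add: numeral_2_eq_2)
  show ?case
    unfolding sum.atMost_Suc Suc gauss_binomial_Pascal[OF assms] e[of N] power_add
    by (simp add: algebra_simps)
qed (use gauss_binomial_0_right[of q "Suc n"] in \<open>simp add: numeral_2_eq_2\<close>)

text \<open>The orthogonality relation behind Moebius inversion on the lattice of subspaces. For
  \<open>n = Suc n'\<close> the closed form contains the Gaussian binomial of \<open>n'\<close> over
  \<open>N > n'\<close>, which is 0.\<close>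

lemma gauss_binomial_alternating_sum:
  assumes "2 \<le> q" and "n \<le> N"
  shows "(\<Sum>j\<le>N. (-1) ^ j * of_nat q ^ (j choose 2) * gauss_binomial q (int n) (int j))
    = (if n = 0 then 1 else 0)"
proof (cases n)
  case 0
  have "(\<Sum>j\<le>N. (-1) ^ j * of_nat q ^ (j choose 2) * gauss_binomial q (int n) (int j))
      = (\<Sum>j\<in>{0}. (-1) ^ j * of_nat q ^ (j choose 2) * gauss_binomial q (int n) (int j))"
    using 0 by (intro sum.mono_neutral_right) (auto simp: gauss_binomial_def)
  then show ?thesis using 0 by (simp add: gauss_binomial_def numeral_2_eq_2)
next
  case (Suc n')
  then show ?thesis
    using assms gauss_binomial_alternating_partial_sum[OF assms(1), where n = n' and N = N]
    by (simp add: gauss_binomial_def)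
qed

lemma schubert_lambda_of_nat:
  assumes "s \<le> a" and "a \<le> b"
  shows "schubert_lambda q (int a) (int b) (int s) (int t) =
    (\<Sum>r\<in>{s..t}. (-1) ^ (r - s) * of_nat q ^ ((r - s) choose 2) *
        gauss_binomial q (int (a - s)) (int (r - s)) * gauss_binomial q (int (b - r)) (int (t - r)))"
proof -
  have "schubert_lambda q (int a) (int b) (int s) (int t) =
    (\<Sum>r\<in>int ` {s..t}. (-1) ^ nat (r - int s) * of_nat q ^ (nat (r - int s) choose 2) *
        gauss_binomial q (int a - int s) (r - int s) * gauss_binomial q (int b - r) (int t - r))"
    unfolding schubert_lambda_def image_int_atLeastAtMost ..
  also have "\<dots> = (\<Sum>r\<in>{s..t}. (-1) ^ nat (int r - int s) * of_nat q ^ (nat (int r - int s) choose 2) *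
        gauss_binomial q (int a - int s) (int r - int s) * gauss_binomial q (int b - int r) (int t - int r))"
    by (subst sum.reindex) (auto intro: inj_onI)
  also have "\<dots> = (\<Sum>r\<in>{s..t}. (-1) ^ (r - s) * of_nat q ^ ((r - s) choose 2) *
        gauss_binomial q (int (a - s)) (int (r - s)) * gauss_binomial q (int (b - r)) (int (t - r)))"
  proof (rule sum.cong[OF refl])
    fix r assume r: "r \<in> {s..t}"
    show "(-1) ^ nat (int r - int s) * of_nat q ^ (nat (int r - int s) choose 2) *
        gauss_binomial q (int a - int s) (int r - int s) * gauss_binomial q (int b - int r) (int t - int r)
      = (-1) ^ (r - s) * of_nat q ^ ((r - s) choose 2) *
        gauss_binomial q (int (a - s)) (int (r - s)) * gauss_binomial q (int (b - r)) (int (t - r))"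
    \<comment> \<open>Truncated and integer \<open>b - r\<close> can differ only for
      \<open>r > b\<close>; then \<open>r > a\<close> by \<open>a \<le> b\<close>, and the first
      Gaussian binomial is 0 on both sides.\<close>
    proof (cases "r \<le> a")
      case True
      then show ?thesis using r assms by (simp add: nat_diff_distrib of_nat_diff)
    next
      case False
      then have "gauss_binomial q (int (a - s)) (int (r - s)) = 0"
        "gauss_binomial q (int a - int s) (int r - int s) = 0"
        using r assms by (auto simp: gauss_binomial_def)
      then show ?thesis by simp
    qed
  qed
  finally show ?thesis .
qed

section \<open>Subspaces with prescribed intersections\<close>

context finite_field_vector_space
begin

text \<open>These subspaces correspond to the \<open>k\<close>-dimensional subspaces of
  \<open>B / S\<close>. No quotient is formed: the count in \<open>card_between_mult\<close> is
  divided out in \<open>rat\<close>.\<close>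

lemma card_between:
  assumes "subspace S" and "subspace B" "finite B" and "S \<subseteq> B"
  shows "of_nat (card {U. subspace U \<and> S \<subseteq> U \<and> U \<subseteq> B \<and> dim U = dim S + k})
    = gauss_binomial CARD('a) (int (dim B - dim S)) (int k)"
proof -
  let ?q = "of_nat CARD('a) :: rat"
  let ?X = "{U. subspace U \<and> S \<subseteq> U \<and> U \<subseteq> B \<and> dim U = dim S + k}"
  define n where "n = dim B - dim S"
  have B: "dim B = dim S + n" using dim_mono_finite[OF assms] n_def by simp
  have of_nat_diff_power: "of_nat (CARD('a) ^ (d + i) - CARD('a) ^ (d + j)) = ?q ^ (d + i) - ?q ^ (d + j)"
    if "j \<le> i" for d i j
    using that card_field_ge_2 by (simp add: of_nat_diff power_increasing)
  show ?thesis
  proof (cases "k \<le> n")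
    case False
    have "?X = {}"
    proof (rule ccontr)
      assume "?X \<noteq> {}"
      then obtain U where "subspace U" "U \<subseteq> B" "dim U = dim S + k" by auto
      then have "dim S + k \<le> dim B" using dim_mono_finite assms by metis
      then show False using B False by simp
    qed
    then show ?thesis using False by (simp only: card.empty) (simp add: gauss_binomial_def n_def)
  next
    case True
    have "of_nat (card ?X) * (\<Prod>i<k. ?q ^ (dim S + k) - ?q ^ (dim S + i))
      = of_nat (card ?X * (\<Prod>i<k. CARD('a) ^ (dim S + k) - CARD('a) ^ (dim S + i)))"
      by (simp add: of_nat_diff_power)
    also have "\<dots> = of_nat (\<Prod>i<k. CARD('a) ^ (dim S + n) - CARD('a) ^ (dim S + i))"
      unfolding card_between_mult[OF assms] B ..
    also have "\<dots> = (\<Prod>i<k. ?q ^ (dim S + n) - ?q ^ (dim S + i))"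
      unfolding of_nat_prod using True by (intro prod.cong refl of_nat_diff_power) simp
    \<comment> \<open>The factor \<open>(q ^ dim S) ^ k\<close> is cancelled on both sides.\<close>
    finally have "of_nat (card ?X) * (\<Prod>i<k. ?q ^ k - ?q ^ i) = (\<Prod>i<k. ?q ^ n - ?q ^ i)"
      using card_field_ge_2 unfolding power_diff_prod_shift by simp
    then show ?thesis
      using power_diff_prod_ne_0[OF card_field_ge_2, where d = 0]
      unfolding gauss_binomial_of_nat prod_dividef n_def[symmetric] by (simp only: add_0 eq_divide_eq) simp
  qed
qed

text \<open>
  The indicator of \<open>W \<inter> A = S\<close> is the alternating \<open>q\<close>-binomial sum over the subspaces \<open>U\<close> with
  \<open>S \<subseteq> U \<subseteq> W \<inter> A\<close>; exchanging the summations over \<open>W\<close> and \<open>U\<close> gives \<open>\<lambda>\<close>.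
\<close>

lemma card_with_intersection:
  assumes S: "subspace S" and A: "subspace A" and B: "subspace B" "finite B"
    and SA: "S \<subseteq> A" and AB: "A \<subseteq> B"
  shows "of_nat (card {W. subspace W \<and> W \<subseteq> B \<and> dim W = t \<and> W \<inter> A = S})
    = schubert_lambda CARD('a) (int (dim A)) (int (dim B)) (int (dim S)) (int t)"
proof -
  let ?s = "dim S"
  let ?c = "\<lambda>r. (-1) ^ (r - ?s) * of_nat CARD('a) ^ ((r - ?s) choose 2) :: rat"
  define X where "X = {W. subspace W \<and> S \<subseteq> W \<and> W \<subseteq> B \<and> dim W = t}"
  define Y where "Y r = {U. subspace U \<and> S \<subseteq> U \<and> U \<subseteq> A \<and> dim U = r}" for r
  have finA: "finite A" using AB B finite_subset by blast
  have finX: "finite X" by (rule finite_subset[of _ "Pow B"]) (use B X_def in auto)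
  have finY: "finite (Y r)" for r by (rule finite_subset[of _ "Pow A"]) (use finA Y_def in auto)
  have indicator: "(\<Sum>r\<in>{?s..t}. ?c r * of_nat (card {U\<in>Y r. U \<subseteq> W})) = (if W \<inter> A = S then 1 else 0)"
    if W: "W \<in> X" for W
  proof -
    have sub: "subspace (W \<inter> A)" and SW: "S \<subseteq> W \<inter> A" and finWA: "finite (W \<inter> A)"
      and finW: "finite W" and st: "?s \<le> t" and dimWA: "dim (W \<inter> A) \<le> t"
    proof -
      show sub: "subspace (W \<inter> A)" using W A by (simp add: X_def subspace_inter)
      show "S \<subseteq> W \<inter> A" using W SA by (auto simp: X_def)
      show "finite (W \<inter> A)" using finA by simp
      show finW: "finite W" using W B finite_subset by (auto simp: X_def)
      show "?s \<le> t" using dim_mono_finite[OF S _ finW] W by (auto simp: X_def)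
      show "dim (W \<inter> A) \<le> t" using dim_mono_finite[OF sub _ finW] W by (auto simp: X_def)
    qed
    have "(\<Sum>r\<in>{?s..t}. ?c r * of_nat (card {U\<in>Y r. U \<subseteq> W}))
      = (\<Sum>r\<in>{?s..t}. ?c r * gauss_binomial CARD('a) (int (dim (W \<inter> A) - ?s)) (int (r - ?s)))"
    proof (rule sum.cong[OF refl])
      fix r assume r: "r \<in> {?s..t}"
      have "{U\<in>Y r. U \<subseteq> W} = {U. subspace U \<and> S \<subseteq> U \<and> U \<subseteq> W \<inter> A \<and> dim U = ?s + (r - ?s)}"
        using r by (auto simp: Y_def)
      then show "?c r * of_nat (card {U\<in>Y r. U \<subseteq> W})
        = ?c r * gauss_binomial CARD('a) (int (dim (W \<inter> A) - ?s)) (int (r - ?s))"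
        using card_between[OF S sub finWA SW] by simp
    qed
    also have "\<dots> = (\<Sum>j\<le>t - ?s. (-1) ^ j * of_nat CARD('a) ^ (j choose 2)
        * gauss_binomial CARD('a) (int (dim (W \<inter> A) - ?s)) (int j))"
      by (rule sum.reindex_bij_witness[where i = "\<lambda>j. j + ?s" and j = "\<lambda>r. r - ?s"]) (use st in auto)
    \<comment> \<open>The sum stops at \<open>t - dim S\<close>, which is at least
      \<open>dim (W \<inter> A) - dim S\<close>, so no nonzero term is cut off.\<close>
    also have "\<dots> = (if dim (W \<inter> A) - ?s = 0 then 1 else 0)"
      by (rule gauss_binomial_alternating_sum[OF card_field_ge_2]) (use dimWA in simp)
    also have "dim (W \<inter> A) - ?s = 0 \<longleftrightarrow> W \<inter> A = S"
      using subspace_eq_if_dim_le[OF S sub finWA SW] by auto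
    finally show ?thesis .
  qed
  have "of_nat (card {W. subspace W \<and> W \<subseteq> B \<and> dim W = t \<and> W \<inter> A = S})
    = of_nat (card {W\<in>X. W \<inter> A = S})"
    by (rule arg_cong[where f = "\<lambda>Z. of_nat (card Z)"]) (auto simp: X_def)
  also have "\<dots> = (\<Sum>W\<in>X. if W \<inter> A = S then 1 else 0 :: rat)"
    using finX by (simp add: sum.If_cases Int_def)
  also have "\<dots> = (\<Sum>W\<in>X. \<Sum>r\<in>{?s..t}. ?c r * of_nat (card {U\<in>Y r. U \<subseteq> W}))"
    using indicator by simp
  also have "\<dots> = (\<Sum>r\<in>{?s..t}. ?c r * (\<Sum>W\<in>X. of_nat (card {U\<in>Y r. U \<subseteq> W})))"
    by (subst sum.swap) (simp add: sum_distrib_left)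
  also have "\<dots> = (\<Sum>r\<in>{?s..t}. ?c r * (gauss_binomial CARD('a) (int (dim A - ?s)) (int (r - ?s))
      * gauss_binomial CARD('a) (int (dim B - r)) (int (t - r))))"
  proof (rule sum.cong[OF refl], rule arg_cong[where f = "(*) (?c _)"])
    fix r assume r: "r \<in> {?s..t}"
    have "(\<Sum>W\<in>X. of_nat (card {U\<in>Y r. U \<subseteq> W})) = (\<Sum>U\<in>Y r. of_nat (card {W\<in>X. U \<subseteq> W}) :: rat)"
      using sum.swap_restrict[OF finX finY, where g = "\<lambda>_ _. 1 :: rat" and R = "\<lambda>W U. U \<subseteq> W"] by simp
    also have "\<dots> = (\<Sum>U\<in>Y r. gauss_binomial CARD('a) (int (dim B - r)) (int (t - r)))"
    proof (rule sum.cong[OF refl])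
      fix U assume U: "U \<in> Y r"
      \<comment> \<open>\<open>S \<subseteq> W\<close> follows from \<open>S \<subseteq> U\<close>,
        so the number of \<open>W\<close> above \<open>U\<close> depends only on the dimension
        \<open>r\<close> of \<open>U\<close>.\<close>
      have "{W\<in>X. U \<subseteq> W} = {W. subspace W \<and> U \<subseteq> W \<and> W \<subseteq> B \<and> dim W = dim U + (t - r)}"
        using r U by (auto simp: X_def Y_def)
      then show "of_nat (card {W\<in>X. U \<subseteq> W}) = gauss_binomial CARD('a) (int (dim B - r)) (int (t - r))"
        using card_between[of U B "t - r"] B U AB by (auto simp: Y_def)
    qed
    also have "\<dots> = of_nat (card (Y r)) * gauss_binomial CARD('a) (int (dim B - r)) (int (t - r))"
      by simp
    also have "of_nat (card (Y r)) = gauss_binomial CARD('a) (int (dim A - ?s)) (int (r - ?s))"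
      using card_between[OF S A finA SA, of "r - ?s"] r by (simp add: Y_def)
    finally show "(\<Sum>W\<in>X. of_nat (card {U\<in>Y r. U \<subseteq> W}))
      = gauss_binomial CARD('a) (int (dim A - ?s)) (int (r - ?s))
      * gauss_binomial CARD('a) (int (dim B - r)) (int (t - r))" .
  qed
  also have "\<dots> = schubert_lambda CARD('a) (int (dim A)) (int (dim B)) (int ?s) (int t)"
    using dim_mono_finite[OF S A finA SA] dim_mono_finite[OF A B AB]
    by (simp add: schubert_lambda_of_nat mult.assoc)
  finally show ?thesis .
qed

text \<open>Induction along the chain: \<open>W\<close> is sent to \<open>W \<inter> A n\<close>,
  and \<open>card_with_intersection\<close> gives all fibres the same size, so the sum over the
  possible intersections becomes a product.\<close>

lemma card_intersection_profile:
  assumes A: "\<And>i. i \<le> n \<Longrightarrow> subspace (A i)" "\<And>i. i \<le> n \<Longrightarrow> finite (A i)"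
    and mono: "\<And>i j. i \<le> j \<Longrightarrow> j \<le> n \<Longrightarrow> A i \<subseteq> A j"
    and A0: "A 0 = {0}" and s0: "s 0 = 0"
  shows "of_nat (card {W. subspace W \<and> W \<subseteq> A n \<and> (\<forall>i\<le>n. dim (W \<inter> A i) = s i)})
    = (\<Prod>i<n. schubert_lambda CARD('a) (int (dim (A i))) (int (dim (A (Suc i)))) (int (s i)) (int (s (Suc i))))"
  using A mono
proof (induction n)
  case 0
  have "dim {0} = 0" by (rule dim_eqI) (auto simp: subspace_single_0)
  then have "{W. subspace W \<and> W \<subseteq> A 0 \<and> (\<forall>i\<le>0. dim (W \<inter> A i) = s i)} = {{0}}"
    using A0 s0 subspace_0 by (auto simp: subspace_single_0 subset_singleton_iff)
  then show ?case by simp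
next
  case (Suc n)
  let ?P = "\<lambda>n. {W. subspace W \<and> W \<subseteq> A n \<and> (\<forall>i\<le>n. dim (W \<inter> A i) = s i)}"
  let ?F = "\<lambda>S. {W. subspace W \<and> W \<subseteq> A (Suc n) \<and> dim W = s (Suc n) \<and> W \<inter> A n = S}"
  have AS: "A n \<subseteq> A (Suc n)" using Suc.prems(3) by simp
  have Un: "?P (Suc n) = (\<Union>S\<in>?P n. ?F S)"
  proof (intro equalityI subsetI)
    fix W assume W: "W \<in> ?P (Suc n)"
    have "(W \<inter> A n) \<inter> A i = W \<inter> A i" if "i \<le> n" for i
      using Suc.prems(3)[of i n] that by auto
    then have "W \<inter> A n \<in> ?P n" using W Suc.prems(1)[of n] by (auto intro: subspace_inter)
    moreover have "W \<inter> A (Suc n) = W" using W by auto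
    then have "W \<in> ?F (W \<inter> A n)" using W by force
    ultimately show "W \<in> (\<Union>S\<in>?P n. ?F S)" by blast
  next
    fix W assume "W \<in> (\<Union>S\<in>?P n. ?F S)"
    then obtain S where S: "S \<in> ?P n" and W: "W \<in> ?F S" by blast
    have "dim (W \<inter> A i) = s i" if "i \<le> Suc n" for i
    proof (cases "i = Suc n")
      case True
      moreover have "W \<inter> A (Suc n) = W" using W by auto
      ultimately show ?thesis using W by simp
    next
      case False
      then have "W \<inter> A i = S \<inter> A i" using W Suc.prems(3)[of i n] that by auto
      then show ?thesis using S False that by simp
    qed
    then show "W \<in> ?P (Suc n)" using W by auto
  qed
  have fin: "finite (?P n)" by (rule finite_subset[of _ "Pow (A n)"]) (use Suc.prems(2) in auto)
  have finF: "finite (?F S)" for S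
    by (rule finite_subset[of _ "Pow (A (Suc n))"]) (use Suc.prems(2) in auto)
  have "of_nat (card (?P (Suc n))) = (\<Sum>S\<in>?P n. of_nat (card (?F S)) :: rat)"
    unfolding Un by (subst card_UN_disjoint) (use fin finF in auto)
  also have "\<dots> = (\<Sum>S\<in>?P n. schubert_lambda CARD('a) (int (dim (A n))) (int (dim (A (Suc n)))) (int (s n)) (int (s (Suc n))))"
  proof (rule sum.cong[OF refl])
    fix S assume S: "S \<in> ?P n"
    then have "S \<inter> A n = S" by auto
    then have "dim S = s n" using S by force
    then show "of_nat (card (?F S)) = schubert_lambda CARD('a) (int (dim (A n))) (int (dim (A (Suc n)))) (int (s n)) (int (s (Suc n)))"
      using card_with_intersection[of S "A n" "A (Suc n)" "s (Suc n)"] S Suc.prems AS by simp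
  qed
  finally show ?case using Suc by simp
qed

end

section \<open>Points of Schubert varieties\<close>

interpretation fq: finite_field_vector_space "fscale :: 'a::{field,finite} \<Rightarrow> ('i \<Rightarrow> 'a) \<Rightarrow> ('i \<Rightarrow> 'a)"
  by unfold_locales

section \<open>The standard flag: coordinates and dimensions\<close>

lemma flag_Suc: "flag (Suc j) = fn.span (insert (std_basis (Suc j)) (std_basis ` {1..j}))"
  by (simp add: flag_def atLeastAtMostSuc_conv)

lemma flag_0: "flag 0 = {0}"
  by (simp add: flag_def)

lemma subspace_ambient: "fn.subspace (ambient m)"
  by (rule fn.subspaceI) (auto simp: ambient_def fscale_def)

text \<open>Turns membership in a flag space into the vanishing of coordinates, the form in which
  inclusions and eliminations are checked below.\<close>

lemma flag_eq_ambient: "flag j = ambient j"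
proof (induction j)
  case 0
  show ?case by (auto simp: flag_0 ambient_def fun_eq_iff)
next
  case (Suc j)
  show ?case
  proof
    show "flag (Suc j) \<subseteq> (ambient (Suc j) :: (nat \<Rightarrow> 'a) set)"
      unfolding flag_def by (rule fn.span_minimal[OF _ subspace_ambient]) (auto simp: ambient_def std_basis_def)
    show "ambient (Suc j) \<subseteq> (flag (Suc j) :: (nat \<Rightarrow> 'a) set)"
    proof
      fix v :: "nat \<Rightarrow> 'a" assume "v \<in> ambient (Suc j)"
      then have "v - fscale (v (Suc j)) (std_basis (Suc j)) \<in> ambient j"
        by (auto simp: ambient_def fscale_def std_basis_def)
      then have "v - fscale (v (Suc j)) (std_basis (Suc j)) \<in> fn.span (std_basis ` {1..j})"
        unfolding Suc[symmetric] flag_def .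
      then show "v \<in> flag (Suc j)"
        unfolding flag_Suc fn.span_breakdown_eq by blast
    qed
  qed
qed

lemma flag_mono: "i \<le> j \<Longrightarrow> flag i \<subseteq> flag j"
  by (auto simp: flag_eq_ambient ambient_def)

lemma subspace_flag: "fn.subspace (flag j)"
  by (simp add: flag_def)

lemma finite_flag: "finite (flag j :: (nat \<Rightarrow> 'a::{field,finite}) set)"
  unfolding flag_def by (rule fq.finite_span) simp

lemma dim_flag: "fn.dim (flag j :: (nat \<Rightarrow> 'a::{field,finite}) set) = j"
proof (induction j)
  case 0
  show ?case by (rule fq.dim_eqI) (auto simp: flag_0)
next
  case (Suc j)
  have "std_basis (Suc j) \<notin> (ambient j :: (nat \<Rightarrow> 'a) set)" by (simp add: ambient_def std_basis_def)
  then have "std_basis (Suc j) \<notin> fn.span (std_basis ` {1..j} :: (nat \<Rightarrow> 'a) set)"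
    unfolding flag_eq_ambient[symmetric] flag_def .
  then have "fn.dim (flag (Suc j) :: (nat \<Rightarrow> 'a) set) = Suc (fn.dim (fn.span (std_basis ` {1..j} :: (nat \<Rightarrow> 'a) set)))"
    unfolding flag_Suc by (intro fq.dim_span_insert finite_flag[unfolded flag_def])
  then show ?case using Suc by (simp add: flag_def)
qed

text \<open>Modulo \<open>flag a\<close> a vector of \<open>flag (Suc a)\<close> is determined by
  its coordinate \<open>Suc a\<close>. If some \<open>w\<close> in the larger intersection has a
  nonzero entry there, then \<open>w\<close> and \<open>W \<inter> flag a\<close> span
  everything.\<close>

lemma dim_Int_flag_Suc_le:
  fixes W :: "(nat \<Rightarrow> 'a::{field,finite}) set"
  assumes "fn.subspace W"
  shows "fn.dim (W \<inter> flag (Suc a)) \<le> Suc (fn.dim (W \<inter> flag a))"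
proof -
  have sub: "fn.subspace (W \<inter> flag a)" for a
    using assms subspace_flag by (rule fn.subspace_inter)
  have fin: "finite (W \<inter> flag a)" for a using finite_flag by blast
  show ?thesis
  proof (cases "W \<inter> flag (Suc a) \<subseteq> W \<inter> flag a")
    case True
    then have "fn.dim (W \<inter> flag (Suc a)) \<le> fn.dim (W \<inter> flag a)" by (intro fq.dim_mono_finite sub fin)
    then show ?thesis by simp
  next
    case False
    then obtain w where w: "w \<in> W" "w \<in> flag (Suc a)" "w \<notin> flag a" by blast
    then have nz: "w (Suc a) \<noteq> 0"
      unfolding flag_eq_ambient ambient_def by (auto simp: le_Suc_eq)
    have *: "W \<inter> flag (Suc a) \<subseteq> fn.span (insert w (W \<inter> flag a))"
    proof
      fix x assume x: "x \<in> W \<inter> flag (Suc a)"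
      \<comment> \<open>Chosen to cancel coordinate \<open>Suc a\<close> of
        \<open>x\<close>.\<close>
      let ?c = "x (Suc a) / w (Suc a)"
      have "x - fscale ?c w \<in> flag a"
        unfolding flag_eq_ambient ambient_def
      proof (intro CollectI allI impI)
        fix i assume "i \<notin> {1..a}"
        then show "(x - fscale ?c w) i = 0"
          using x w(2) nz by (cases "i = Suc a") (auto simp: flag_eq_ambient ambient_def fscale_def)
      qed
      moreover have "x - fscale ?c w \<in> W"
        using x w(1) assms by (simp add: fn.subspace_diff fn.subspace_scale)
      ultimately have "x - fscale ?c w \<in> fn.span (W \<inter> flag a)" by (simp add: fn.span_base)
      then show "x \<in> fn.span (insert w (W \<inter> flag a))" unfolding fn.span_breakdown_eq by blast
    qed
    have nin: "w \<notin> fn.span (W \<inter> flag a)" using w sub[of a] by (simp add: fn.span_eq_iff[THEN iffD2])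
    have fins: "finite (fn.span (W \<inter> flag a))" using sub[of a] fin[of a] by (simp add: fn.span_eq_iff[THEN iffD2])
    have "fn.dim (W \<inter> flag (Suc a)) \<le> fn.dim (fn.span (insert w (W \<inter> flag a)))"
      by (rule fq.dim_mono_finite) (use sub * fq.card_span_insert(1)[OF fins nin] in auto)
    also have "\<dots> = Suc (fn.dim (W \<inter> flag a))"
      using fq.dim_span_insert[OF fins nin] by simp
    finally show ?thesis .
  qed
qed

section \<open>Reduction to the block ends and stratification\<close>

lemma exists_block_index:
  fixes p :: "nat \<Rightarrow> nat"
  assumes "p 0 < j" and "j < p n" and "j \<notin> p ` {0..n}"
  shows "\<exists>i<n. p i < j \<and> j < p (Suc i)"
  using assms(2,3)
proof (induction n)
  case 0
  then show ?case using assms(1) by simp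
next
  case (Suc n)
  have "p n \<noteq> j" "j \<notin> p ` {0..n}" using Suc.prems(2) by auto
  then show ?case
  proof (cases "p n < j")
    case True
    then show ?thesis using Suc.prems by blast
  next
    case False
    then have "j < p n" using \<open>p n \<noteq> j\<close> by simp
    then obtain i where "i < n" "p i < j" "j < p (Suc i)"
      using Suc.IH \<open>j \<notin> p ` {0..n}\<close> by blast
    then show ?thesis using less_SucI by blast
  qed
qed

text \<open>Inside a block \<open>\<alpha>\<close> grows by one, so the condition at
  \<open>Suc j\<close> implies the one at \<open>j\<close>. The condition at \<open>l\<close>
  becomes \<open>W \<subseteq> flag (\<alpha> l)\<close>, and only those at \<open>p 1\<close> to
  \<open>p u\<close> remain.\<close>

lemma schubert_variety_block_conditions:
  fixes \<alpha> p :: "nat \<Rightarrow> nat"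
  assumes l: "1 \<le> l" "\<alpha> l \<le> m"
    and p: "p 0 = 0" "p (Suc u) = l" "strict_mono_on {0..Suc u} p"
    and blocks: "\<And>i j. i \<le> u \<Longrightarrow> p i < j \<Longrightarrow> j < p (Suc i) \<Longrightarrow> \<alpha> (Suc j) = Suc (\<alpha> j)"
  shows "schubert_variety l m \<alpha> = {W :: (nat \<Rightarrow> 'a::{field,finite}) set.
    fn.subspace W \<and> W \<subseteq> flag (\<alpha> l) \<and> fn.dim W = l \<and>
    (\<forall>i\<in>{1..u}. p i \<le> fn.dim (W \<inter> flag (\<alpha> (p i))))}" (is "?L = ?R")
proof (intro equalityI subsetI)
  fix W assume "W \<in> ?L"
  then have W: "fn.subspace W" "W \<subseteq> ambient m" "fn.dim W = l"
    and c: "\<And>i. i \<in> {1..l} \<Longrightarrow> i \<le> fn.dim (W \<inter> flag (\<alpha> i))"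
    by (auto simp: schubert_variety_def grassmannian_def)
  have fin: "finite W" using W(2) finite_flag[of m] finite_subset unfolding flag_eq_ambient by blast
  have "W \<inter> flag (\<alpha> l) = W"
    by (rule fq.subspace_eq_if_dim_le)
      (use W c[of l] fin l in \<open>auto intro: fn.subspace_inter simp: subspace_flag\<close>)
  moreover have "p i \<in> {1..l}" if "i \<in> {1..u}" for i
    using that p strict_mono_onD[OF p(3), of 0 i] strict_mono_onD[OF p(3), of i "Suc u"] by auto
  ultimately show "W \<in> ?R" using W c by blast
next
  fix W assume W: "W \<in> ?R"
  have c: "i \<le> fn.dim (W \<inter> flag (\<alpha> i))" if "1 \<le> i" "i \<le> l" for i
    using that(2,1)
  \<comment> \<open>Descending from \<open>l\<close>: at a block end the condition is given,
    elsewhere it is inherited from \<open>Suc j\<close>.\<close>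
  proof (induction i rule: inc_induct)
    case base
    have "W \<inter> flag (\<alpha> l) = W" using W by auto
    then show ?case using W by simp
  next
    case (step j)
    show ?case
    proof (cases "j \<in> p ` {0..Suc u}")
      case True
      then obtain i where i: "j = p i" "i \<le> Suc u" by auto
      moreover have "i \<noteq> 0" using i step p(1) by (intro notI) simp
      moreover have "i \<noteq> Suc u" using i step p(2) by (intro notI) simp
      ultimately show ?thesis using W by auto
    next
      case False
      then obtain i where "i < Suc u" "p i < j" "j < p (Suc i)"
        using exists_block_index[of p j "Suc u"] step p(1,2) by auto
      then have "\<alpha> (Suc j) = Suc (\<alpha> j)" using blocks[of i j] by simp
      then show ?thesis using step W dim_Int_flag_Suc_le[of W "\<alpha> j"] by simp
    qed
  qed
  have "W \<subseteq> ambient m" using W flag_mono[OF l(2)] unfolding flag_eq_ambient by blast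
  then show "W \<in> ?L" using W c by (auto simp: schubert_variety_def grassmannian_def)
qed

lemma card_schubert_variety:
  fixes \<alpha> p :: "nat \<Rightarrow> nat"
  assumes l: "1 \<le> l" "\<alpha> l \<le> m"
    and \<alpha>: "\<alpha> 0 = 0" "mono_on {0..l} \<alpha>"
    and p: "p 0 = 0" "p (Suc u) = l" "strict_mono_on {0..Suc u} p"
    and blocks: "\<And>i j. i \<le> u \<Longrightarrow> p i < j \<Longrightarrow> j < p (Suc i) \<Longrightarrow> \<alpha> (Suc j) = Suc (\<alpha> j)"
  shows "of_nat (card (schubert_variety l m \<alpha> :: (nat \<Rightarrow> 'a::{field,finite}) set set)) =
      (\<Sum>s\<in>(\<Pi>\<^sub>E i\<in>{1..u}. {p i..\<alpha> (p i)}). \<Prod>i\<le>u.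
         schubert_lambda CARD('a) (int (\<alpha> (p i))) (int (\<alpha> (p (Suc i))))
           (int ((s(0 := 0, Suc u := l)) i)) (int ((s(0 := 0, Suc u := l)) (Suc i))))"
proof -
  define A where "A i = (flag (\<alpha> (p i)) :: (nat \<Rightarrow> 'a) set)" for i
  let ?I = "\<Pi>\<^sub>E i\<in>{1..u}. {p i..\<alpha> (p i)}"
  \<comment> \<open>Pads \<open>s\<close> with the forced values at the ends of the chain, where
    \<open>A 0 = {0}\<close> and \<open>W \<subseteq> A (Suc u)\<close> with
    \<open>dim W = l\<close>.\<close>
  let ?s = "\<lambda>s :: nat \<Rightarrow> nat. s(0 := 0, Suc u := l)"
  let ?F = "\<lambda>s. {W. fn.subspace W \<and> W \<subseteq> A (Suc u) \<and> (\<forall>i\<le>Suc u. fn.dim (W \<inter> A i) = ?s s i)}"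
  have p_mono: "p i \<le> p j" if "i \<le> j" "j \<le> Suc u" for i j
    using that strict_mono_onD[OF p(3), of i j] by (cases "i = j") auto
  have A: "fn.subspace (A i)" "finite (A i)" "fn.dim (A i) = \<alpha> (p i)" for i
    by (simp_all add: A_def subspace_flag finite_flag dim_flag)
  have A0: "A 0 = {0}" by (simp add: A_def p \<alpha> flag_0)
  have A_mono: "A i \<subseteq> A j" if "i \<le> j" "j \<le> Suc u" for i j
    unfolding A_def using p_mono[OF that] p_mono[OF that(2)] p(2)
    by (intro flag_mono mono_onD[OF \<alpha>(2)]) auto
  have conditions: "schubert_variety l m \<alpha> = {W :: (nat \<Rightarrow> 'a) set.
      fn.subspace W \<and> W \<subseteq> flag (\<alpha> l) \<and> fn.dim W = l \<and>
      (\<forall>i\<in>{1..u}. p i \<le> fn.dim (W \<inter> flag (\<alpha> (p i))))}"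
    by (rule schubert_variety_block_conditions[where p = p and u = u]) (fact l p | rule blocks; assumption)+
  have Un: "schubert_variety l m \<alpha> = (\<Union>s\<in>?I. ?F s)"
  proof (intro equalityI subsetI)
    fix W :: "(nat \<Rightarrow> 'a) set" assume "W \<in> schubert_variety l m \<alpha>"
    then have W: "fn.subspace W" "W \<subseteq> A (Suc u)" "fn.dim W = l"
      and c: "\<And>i. i \<in> {1..u} \<Longrightarrow> p i \<le> fn.dim (W \<inter> A i)"
      unfolding conditions A_def p(2) by auto
    define s where "s = restrict (\<lambda>i. fn.dim (W \<inter> A i)) {1..u}"
    have "fn.dim (W \<inter> A i) \<le> \<alpha> (p i)" for i
      using fq.dim_mono_finite[of "W \<inter> A i" "A i"] fn.subspace_inter[OF W(1)] A by auto
    then have "s \<in> ?I" using c by (auto simp: s_def)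
    moreover have "fn.dim (W \<inter> A i) = ?s s i" if "i \<le> Suc u" for i
    proof -
      have "W \<inter> A (Suc u) = W" using W by auto
      moreover have "W \<inter> A 0 = flag 0" using fn.subspace_0[OF W(1)] by (auto simp: A0 flag_0)
      ultimately show ?thesis using that W(3) dim_flag[of 0] by (auto simp: s_def)
    qed
    ultimately show "W \<in> (\<Union>s\<in>?I. ?F s)" using W by blast
  next
    fix W :: "(nat \<Rightarrow> 'a) set" assume "W \<in> (\<Union>s\<in>?I. ?F s)"
    then obtain s where s: "s \<in> ?I" and W: "W \<in> ?F s" by blast
    have "W \<inter> A (Suc u) = W" using W by auto
    then have "fn.dim W = l" using W by force
    moreover have "p i \<le> fn.dim (W \<inter> A i)" if "i \<in> {1..u}" for i
      using s W that by (auto simp: PiE_iff)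
    ultimately show "W \<in> schubert_variety l m \<alpha>"
      unfolding conditions using W by (auto simp: A_def p(2))
  qed
  have disj: "?F s \<inter> ?F s' = {}" if "s \<in> ?I" "s' \<in> ?I" "s \<noteq> s'" for s s'
  proof (rule ccontr)
    assume "?F s \<inter> ?F s' \<noteq> {}"
    then obtain W where "W \<in> ?F s" "W \<in> ?F s'" by blast
    then have eq: "?s s i = ?s s' i" if "i \<le> Suc u" for i using that by simp
    have "s i = s' i" if "i \<in> {1..u}" for i using eq[of i] that by simp
    \<comment> \<open>Elements of the product are extensional, so agreement on \<open>{1..u}\<close>
      suffices.\<close>
    then have "s = s'" using that(1,2) by (intro PiE_ext[of s _ _ s'])
    then show False using that by simp
  qed
  have "finite (?F s)" for s
    by (rule finite_subset[of _ "Pow (A (Suc u))"]) (use A in auto)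
  then have "card (schubert_variety l m \<alpha> :: (nat \<Rightarrow> 'a) set set) = (\<Sum>s\<in>?I. card (?F s))"
    unfolding Un using disj by (intro card_UN_disjoint) (auto intro!: finite_PiE)
  then have "of_nat (card (schubert_variety l m \<alpha> :: (nat \<Rightarrow> 'a) set set)) = (\<Sum>s\<in>?I. of_nat (card (?F s)) :: rat)"
    by simp
  also have "\<dots> = (\<Sum>s\<in>?I. \<Prod>i<Suc u. schubert_lambda CARD('a) (int (fn.dim (A i))) (int (fn.dim (A (Suc i))))
      (int (?s s i)) (int (?s s (Suc i))))"
  proof (rule sum.cong[OF refl])
    fix s
    show "of_nat (card (?F s)) = (\<Prod>i<Suc u. schubert_lambda CARD('a) (int (fn.dim (A i))) (int (fn.dim (A (Suc i))))
        (int (?s s i)) (int (?s s (Suc i))))"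
      by (rule fq.card_intersection_profile) (simp_all add: A A_mono A0)
  qed
  finally show ?thesis unfolding A(3) lessThan_Suc_atMost .
qed

section \<open>Injectivity of the Pluecker embedding\<close>

text \<open>Columns are given by a list, possibly unsorted or with repetitions, so that they can be
  added and removed without sorting; \<open>wedge\<close> uses the sorted list of an index
  set.\<close>

definition minor :: "('i \<Rightarrow> 'a::comm_ring_1) list \<Rightarrow> 'i list \<Rightarrow> 'a" where
  "minor ws js = det (mat (length ws) (length ws) (\<lambda>(i, j). (ws ! i) (js ! j)))"

definition remove_nth :: "nat \<Rightarrow> 'b list \<Rightarrow> 'b list" where
  "remove_nth i xs = take i xs @ drop (Suc i) xs"

lemma length_remove_nth: "i < length xs \<Longrightarrow> length (remove_nth i xs) = length xs - 1"
  by (simp add: remove_nth_def)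

lemma nth_remove_nth:
  "i < length xs \<Longrightarrow> k < length xs - 1 \<Longrightarrow> remove_nth i xs ! k = xs ! (if k < i then k else Suc k)"
  by (auto simp: remove_nth_def nth_append)

lemma set_remove_nth: "set (remove_nth i xs) \<subseteq> set xs"
  by (auto simp: remove_nth_def dest: in_set_takeD in_set_dropD)

text \<open>The cofactors involve only \<open>ws\<close>, so the minor is linear in
  \<open>v\<close>.\<close>

lemma minor_Cons_row:
  assumes "length js = Suc (length ws)"
  shows "minor (v # ws) js = (\<Sum>k<length js. v (js ! k) * ((-1) ^ k * minor ws (remove_nth k js)))"
proof -
  let ?n = "length js"
  let ?M = "mat ?n ?n (\<lambda>(i, j). ((v # ws) ! i) (js ! j))"
  have "minor (v # ws) js = (\<Sum>k<?n. ?M $$ (0, k) * cofactor ?M 0 k)"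
    unfolding minor_def using assms by (subst laplace_expansion_row[where n = ?n and i = 0]) auto
  also have "\<dots> = (\<Sum>k<?n. v (js ! k) * ((-1) ^ k * minor ws (remove_nth k js)))"
  proof (rule sum.cong[OF refl])
    fix k assume k: "k \<in> {..<?n}"
    have "mat_delete ?M 0 k = mat (length ws) (length ws) (\<lambda>(i, j). (ws ! i) (remove_nth k js ! j))"
      by (rule eq_matI) (use k assms in \<open>auto simp: mat_delete_def nth_remove_nth\<close>)
    then show "?M $$ (0, k) * cofactor ?M 0 k = v (js ! k) * ((-1) ^ k * minor ws (remove_nth k js))"
      using k assms by (simp add: cofactor_def minor_def)
  qed
  finally show ?thesis .
qed

text \<open>Here the cofactors do not involve the new column \<open>j\<close>, which can therefore
  vary.\<close>

lemma minor_Cons_column: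
  assumes "length ws = Suc (length js)"
  shows "minor ws (j # js) = (\<Sum>k<length ws. (ws ! k) j * ((-1) ^ k * minor (remove_nth k ws) js))"
proof -
  let ?n = "length ws"
  let ?M = "mat ?n ?n (\<lambda>(i, k). (ws ! i) ((j # js) ! k))"
  have "minor ws (j # js) = (\<Sum>k<?n. ?M $$ (k, 0) * cofactor ?M k 0)"
    unfolding minor_def using assms by (subst laplace_expansion_column[where n = ?n and j = 0]) auto
  also have "\<dots> = (\<Sum>k<?n. (ws ! k) j * ((-1) ^ k * minor (remove_nth k ws) js))"
  proof (rule sum.cong[OF refl])
    fix k assume k: "k \<in> {..<?n}"
    have "mat_delete ?M k 0 = mat (length js) (length js) (\<lambda>(i, j). (remove_nth k ws ! i) (js ! j))"
      by (rule eq_matI) (use k assms in \<open>auto simp: mat_delete_def nth_remove_nth\<close>)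
    then show "?M $$ (k, 0) * cofactor ?M k 0 = (ws ! k) j * ((-1) ^ k * minor (remove_nth k ws) js)"
      using k assms by (simp add: cofactor_def minor_def length_remove_nth)
  qed
  finally show ?thesis .
qed

text \<open>By the expansion along \<open>v\<close>, the vectors \<open>v\<close> with vanishing
  minor form a subspace; it contains each entry of \<open>ws\<close>, since then two rows
  coincide.\<close>

lemma minor_eq_0_if_in_span:
  fixes ws :: "('i \<Rightarrow> 'a::field) list"
  assumes "v \<in> fn.span (set ws)" and "length js = Suc (length ws)"
  shows "minor (v # ws) js = 0"
proof -
  let ?Z = "{v. minor (v # ws) js = 0}"
  have "fn.subspace ?Z"
    unfolding minor_Cons_row[OF assms(2)]
    by (rule fn.subspaceI)
      (auto simp: distrib_right sum.distrib fscale_def mult.assoc simp flip: sum_distrib_left)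
  moreover have "set ws \<subseteq> ?Z"
  proof
    fix w assume "w \<in> set ws"
    then obtain i where i: "i < length ws" "w = ws ! i" by (metis in_set_conv_nth)
    let ?M = "mat (Suc (length ws)) (Suc (length ws)) (\<lambda>(i, j). ((w # ws) ! i) (js ! j))"
    have "row ?M 0 = row ?M (Suc i)" using i by (intro eq_vecI) auto
    then have "det ?M = 0" using i by (intro det_identical_rows[where n = "Suc (length ws)" and i = 0 and j = "Suc i"]) auto
    then show "w \<in> ?Z" by (simp add: minor_def)
  qed
  ultimately have "fn.span (set ws) \<subseteq> ?Z" by (intro fn.span_minimal)
  then show ?thesis using assms by blast
qed

lemma sum_fun_apply: "(\<Sum>k\<in>A. f k) x = (\<Sum>k\<in>A. f k x)"
  by (induction A rule: infinite_finite_induct) auto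

text \<open>Either the head lies in the span of the tail, or the tail already has a repetition or a
  dependence and all cofactors of the head vanish by induction.\<close>

lemma minor_eq_0_if_dependent:
  fixes ws :: "('i \<Rightarrow> 'a::field) list"
  assumes "length js = length ws" and "\<not> (distinct ws \<and> fn.independent (set ws))"
  shows "minor ws js = 0"
  using assms
proof (induction ws arbitrary: js)
  case Nil
  then show ?case by (simp add: fn.independent_empty)
next
  case (Cons v ws)
  show ?case
  proof (cases "v \<in> fn.span (set ws)")
    case True
    then show ?thesis using Cons.prems by (simp add: minor_eq_0_if_in_span)
  next
    case False
    then have "v \<notin> set ws" using fn.span_base by blast
    then have "\<not> (distinct ws \<and> fn.independent (set ws))"
      using False Cons.prems(2) fn.independent_insertI by auto
    then have "minor ws (remove_nth k js) = 0" if "k < length js" for k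
      using Cons.prems(1) that by (intro Cons.IH) (simp_all add: length_remove_nth)
    then show ?thesis using Cons.prems(1) by (simp add: minor_Cons_row)
  qed
qed

text \<open>Full row rank gives a nonzero maximal minor. \<open>I\<close> contains the supports of
  all rows, so for rows in \<open>ambient m\<close> the columns can be found in
  \<open>{1..m}\<close>.\<close>

lemma exists_minor_ne_0:
  fixes ws :: "('i \<Rightarrow> 'a::field) list"
  assumes "distinct ws" and "fn.independent (set ws)"
    and "\<And>w i. w \<in> set ws \<Longrightarrow> i \<notin> I \<Longrightarrow> w i = 0"
  shows "\<exists>js. length js = length ws \<and> set js \<subseteq> I \<and> minor ws js \<noteq> 0"
  using assms
proof (induction ws)
  case Nil
  then show ?case by (intro exI[of _ "[]"]) (simp add: minor_def)
next
  case (Cons v ws)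
  have ind: "fn.independent (set ws)" and v: "v \<notin> fn.span (set ws)"
    using Cons.prems(1,2) by (auto simp: fn.independent_insert)
  then obtain js where js: "length js = length ws" "set js \<subseteq> I" "minor ws js \<noteq> 0"
    using Cons by auto
  \<comment> \<open>Expanding along a new first column \<open>j\<close> gives cofactors \<open>c k\<close> that do not depend on \<open>j\<close>; if all
    these minors vanished, the \<open>c k\<close> would be a linear relation, with \<open>c 0 \<noteq> 0\<close>.\<close>
  have "\<exists>j\<in>I. minor (v # ws) (j # js) \<noteq> 0"
  proof (rule ccontr)
    assume neg: "\<not> ?thesis"
    define c where "c k = (-1) ^ k * minor (remove_nth k (v # ws)) js" for k
    \<comment> \<open>A relation between vectors has to hold at every coordinate; outside
      \<open>I\<close> all rows vanish.\<close>
    have sum0: "(\<Sum>k<Suc (length ws). ((v # ws) ! k) j * c k) = 0" for j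
    proof (cases "j \<in> I")
      case True
      then have "minor (v # ws) (j # js) = 0" using neg by blast
      then show ?thesis using js by (simp add: minor_Cons_column c_def del: sum.lessThan_Suc)
    next
      case False
      then have "((v # ws) ! k) j = 0" if "k < Suc (length ws)" for k
        using Cons.prems(3)[of "(v # ws) ! k" j] that nth_mem[of k "v # ws"] by simp
      then show ?thesis by simp
    qed
    have c0: "c 0 \<noteq> 0" using js by (simp add: c_def remove_nth_def)
    have "v = (\<Sum>k<length ws. fscale (- c (Suc k) / c 0) (ws ! k))"
    proof
      fix j
      have "v j * c 0 + (\<Sum>k<length ws. (ws ! k) j * c (Suc k)) = 0"
        using sum0[of j] by (subst (asm) sum.lessThan_Suc_shift) simp
      then have "v j * c 0 = - (\<Sum>k<length ws. (ws ! k) j * c (Suc k))"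
        by (simp add: eq_neg_iff_add_eq_0)
      then have "v j = - (\<Sum>k<length ws. (ws ! k) j * c (Suc k)) / c 0"
        using c0 by (simp add: field_simps)
      also have "\<dots> = (\<Sum>k<length ws. (- c (Suc k) / c 0) * (ws ! k) j)"
        by (simp add: sum_negf sum_divide_distrib mult.commute)
      also have "\<dots> = (\<Sum>k<length ws. fscale (- c (Suc k) / c 0) (ws ! k)) j"
        by (simp add: sum_fun_apply fscale_def)
      finally show "v j = (\<Sum>k<length ws. fscale (- c (Suc k) / c 0) (ws ! k)) j" .
    qed
    also have "\<dots> \<in> fn.span (set ws)"
      by (intro fn.span_sum fn.span_scale fn.span_base) simp
    finally show False using v by blast
  qed
  then obtain j where "j \<in> I" "minor (v # ws) (j # js) \<noteq> 0" by blast
  then show ?case using js by (intro exI[of _ "j # js"]) simp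
qed

section \<open>From minors with column lists to wedge coordinates\<close>

lemma minor_permute_columns:
  fixes ws :: "('i \<Rightarrow> 'a::comm_ring_1) list"
  assumes "p permutes {..<length js}" and "length ws = length js"
  shows "minor ws (permute_list p js) = signof p * minor ws js"
proof -
  let ?n = "length js"
  \<comment> \<open>The transpose of the matrix in \<open>minor\<close>, because the determinant
    rule applied here permutes rows.\<close>
  let ?M = "mat ?n ?n (\<lambda>(i, j). (ws ! j) (js ! i))"
  have lt: "p i < ?n" if "i < ?n" for i
    using permutes_in_image[OF assms(1), of i] that by simp
  have p: "p permutes {0..<?n}" using assms(1) by (simp add: atLeast0LessThan)
  have "minor ws (permute_list p js) = det ((mat ?n ?n (\<lambda>(i, j). ?M $$ (p i, j)))\<^sup>T)"
    unfolding minor_def by (rule arg_cong[where f = det], rule eq_matI)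
      (auto simp: assms permute_list_nth lt)
  also have "\<dots> = signof p * det ?M"
    by (subst det_transpose[where n = ?n]) (auto intro!: det_permute_rows[where n = ?n] p)
  also have "det ?M = det (?M\<^sup>T)" by (simp add: det_transpose[where n = ?n])
  also have "?M\<^sup>T = mat ?n ?n (\<lambda>(i, j). (ws ! i) (js ! j))" by (rule eq_matI) auto
  finally show ?thesis by (simp add: minor_def assms)
qed

text \<open>The factor is the sign of the permutation relating \<open>js\<close> to its sorted form,
  or 0 if a column repeats. It is chosen before \<open>ws\<close>, hence constant as the rows
  vary.\<close>

lemma minor_eq_mult_wedge:
  assumes "set js \<subseteq> {1..m}"
  shows "\<exists>c. \<forall>ws :: (nat \<Rightarrow> 'a::field) list. length ws = length js \<longrightarrow> minor ws js = c * wedge m ws (set js)"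
proof (cases "distinct js")
  case True
  let ?js = "sorted_list_of_set (set js)"
  have "mset js = mset ?js" using True
    by (simp add: sorted_list_of_set_sort_remdups distinct_remdups_id)
  then obtain p where p: "p permutes {..<length ?js}" "permute_list p ?js = js"
    by (rule mset_eq_permutation)
  have len: "length ?js = length js" using True by (simp add: distinct_card)
  have "minor ws js = signof p * wedge m ws (set js)" if "length ws = length js" for ws :: "(nat \<Rightarrow> 'a) list"
    using minor_permute_columns[OF p(1), of ws] p(2) that True assms len
    by (simp add: wedge_def minor_def distinct_card)
  then show ?thesis by blast
next
  case False
  then obtain i j where ij: "i < length js" "j < length js" "i \<noteq> j" "js ! i = js ! j"
    by (auto simp: distinct_conv_nth)
  have "minor ws js = 0" if "length ws = length js" for ws :: "(nat \<Rightarrow> 'a) list"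
    unfolding minor_def that
    by (rule det_identical_columns[where n = "length js" and i = i and j = j]) (use ij in \<open>auto intro!: eq_vecI\<close>)
  then show ?thesis by (intro exI[of _ 0]) simp
qed

text \<open>
  Up to signs, the expansion along \<open>v\<close> is a linear functional of the wedge product of the other
  rows.  It vanishes on the generators of the line of \<open>W\<close>, hence on the whole line.
\<close>

lemma minor_Cons_eq_0_on_pluecker:
  fixes W :: "(nat \<Rightarrow> 'a::{field,finite}) set"
  assumes W: "fn.subspace W" "finite W" "fn.dim W = l"
    and v: "v \<in> W" and js: "length js = Suc l" "set js \<subseteq> {1..m}"
    and ws: "length ws = l" "wedge m ws \<in> pluecker l m W"
  shows "minor (v # ws) js = 0"
proof -
  have "\<exists>c. \<forall>ws :: (nat \<Rightarrow> 'a) list. length ws = l \<longrightarrow>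
      minor ws (remove_nth k js) = c * wedge m ws (set (remove_nth k js))" if "k < length js" for k
    using minor_eq_mult_wedge[of "remove_nth k js" m] set_remove_nth[of k js] js that
    by (simp add: length_remove_nth) blast
  then obtain c where c: "minor ws (remove_nth k js) = c k * wedge m ws (set (remove_nth k js))"
    if "k < length js" "length ws = l" for k and ws :: "(nat \<Rightarrow> 'a) list"
    by metis
  let ?\<phi> = "\<lambda>x. \<Sum>k<length js. v (js ! k) * ((-1) ^ k * (c k * x (set (remove_nth k js))))"
  have \<phi>: "minor (v # us) js = ?\<phi> (wedge m us)" if "length us = l" for us
    using that js by (simp add: minor_Cons_row c)
  have "fn.subspace {x. ?\<phi> x = 0}"
  proof (rule fn.subspaceI)
    fix x y assume "x \<in> {x. ?\<phi> x = 0}" "y \<in> {x. ?\<phi> x = 0}"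
    moreover have "?\<phi> (x + y) = ?\<phi> x + ?\<phi> y"
      unfolding sum.distrib[symmetric] by (simp add: distrib_left)
    ultimately show "x + y \<in> {x. ?\<phi> x = 0}" by (simp only: mem_Collect_eq) simp
  next
    fix a x assume "x \<in> {x. ?\<phi> x = 0}"
    moreover have "?\<phi> (fscale a x) = a * ?\<phi> x"
      unfolding sum_distrib_left by (simp add: fscale_def ac_simps)
    ultimately show "fscale a x \<in> {x. ?\<phi> x = 0}" by (simp only: mem_Collect_eq) simp
  qed simp
  moreover have "{wedge m us |us. length us = l \<and> set us \<subseteq> W} \<subseteq> {x. ?\<phi> x = 0}"
  proof clarify
    fix us assume us: "l = length us" "set us \<subseteq> W"
    \<comment> \<open>These are \<open>l + 1\<close> vectors of the \<open>l\<close>-dimensional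
      \<open>W\<close>.\<close>
    have "\<not> (distinct (v # us) \<and> fn.independent (set (v # us)))"
    proof
      assume "distinct (v # us) \<and> fn.independent (set (v # us))"
      then have "fn.dim (fn.span (set (v # us))) = Suc l"
        using us(1) by (simp add: fn.dim_eq_card_independent distinct_card)
      moreover have "fn.span (set (v # us)) \<subseteq> W"
        using us v W(1) by (intro fn.span_minimal) auto
      then have "fn.dim (fn.span (set (v # us))) \<le> fn.dim W"
        by (intro fq.dim_mono_finite W fn.subspace_span)
      ultimately show False using W(3) by simp
    qed
    then have "minor (v # us) js = 0" using us js by (intro minor_eq_0_if_dependent) simp
    then show "?\<phi> (wedge m us) = 0" using \<phi>[of us] us(1) by simp
  qed
  ultimately have "pluecker l m W \<subseteq> {x. ?\<phi> x = 0}"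
    unfolding pluecker_def by (intro fn.span_minimal)
  then show ?thesis using \<phi>[OF ws(1)] ws(2) by auto
qed

text \<open>The inclusion is reversed: for a basis \<open>ws\<close> of \<open>W\<close> and
  \<open>v\<close> in \<open>W'\<close>, all maximal minors of \<open>v # ws\<close> vanish, so
  \<open>v\<close> depends on \<open>ws\<close>. Equal lines give both inclusions.\<close>

lemma subset_if_pluecker_subset:
  fixes W W' :: "(nat \<Rightarrow> 'a::{field,finite}) set"
  assumes W: "W \<in> grassmannian l m" and W': "W' \<in> grassmannian l m"
    and sub: "pluecker l m W \<subseteq> pluecker l m W'"
  shows "W' \<subseteq> W"
proof
  fix v assume v: "v \<in> W'"
  have fin: "finite W" "finite W'"
    using W W' finite_flag[of m] finite_subset unfolding flag_eq_ambient grassmannian_def by blast+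
  obtain B where B: "B \<subseteq> W" "fn.independent B" "W \<subseteq> fn.span B" "card B = fn.dim W"
    using fn.basis_exists by blast
  then obtain ws where ws: "set ws = B" "distinct ws"
    using finite_distinct_list fin finite_subset by metis
  have len: "length ws = l" using ws B W by (simp add: distinct_card[symmetric] grassmannian_def)
  have "wedge m ws \<in> pluecker l m W"
    unfolding pluecker_def using ws B len by (intro fn.span_base) blast
  then have "minor (v # ws) js = 0" if "length js = Suc l" "set js \<subseteq> {1..m}" for js
    using minor_Cons_eq_0_on_pluecker[of W' l v js m ws] that W' fin v len sub
    by (auto simp: grassmannian_def)
  moreover have "set (v # ws) \<subseteq> ambient m"
    using W W' v ws B by (auto simp: grassmannian_def)
  ultimately have "\<not> (distinct (v # ws) \<and> fn.independent (set (v # ws)))"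
    using exists_minor_ne_0[of "v # ws" "{1..m}"] len by (fastforce simp: ambient_def)
  then have "v \<in> fn.span B"
    using ws B fn.span_base[of v B] fn.independent_insertI[of v B] by auto
  then show "v \<in> W" using B(1) W fn.span_minimal[of B W] by (auto simp: grassmannian_def)
qed

lemma inj_on_pluecker: "inj_on (pluecker l m) (grassmannian l m :: (nat \<Rightarrow> 'a::{field,finite}) set set)"
  by (rule inj_onI) (simp add: subset_antisym subset_if_pluecker_subset)

section \<open>The length of the code\<close>

lemma code_length_is_code_of:
  assumes "is_code_of X C"
  shows "code_length C = card X"
proof -
  obtain xs where xs: "distinct (map (\<lambda>x. fn.span {x}) xs)" "set (map (\<lambda>x. fn.span {x}) xs) = X"
    and C: "C = {map f xs | f. linear_form_on (fn.span (set xs)) f}"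
    using assms unfolding is_code_of_def by blast
  \<comment> \<open>The zero form shows that the code is nonempty, so the common length of its words
    is unique.\<close>
  have "linear_form_on (fn.span (set xs)) (\<lambda>_. 0)" by (simp add: linear_form_on_def)
  then have "map (\<lambda>_. 0) xs \<in> C" unfolding C by blast
  then have "code_length C = length xs"
    unfolding code_length_def by (intro the_equality) (auto simp: C)
  also have "\<dots> = card X" using distinct_card[OF xs(1)] xs(2) by simp
  finally show ?thesis .
qed

theorem theorem2p4:
  fixes l m u :: nat and \<alpha> p :: "nat \<Rightarrow> nat"
  assumes "1 \<le> l" and "l \<le> m"
    and "\<forall>i\<in>{1..l}. 1 \<le> \<alpha> i \<and> \<alpha> i \<le> m"
    and "strict_mono_on {1..l} \<alpha>"
    and "\<alpha> 0 = 0"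
    and "p 0 = 0" and "p (u + 1) = l"
    and "strict_mono_on {0..u + 1} p"
    and "\<forall>i\<le>u. \<forall>j. p i + 1 \<le> j \<and> j < p (i + 1) \<longrightarrow> \<alpha> (j + 1) = \<alpha> j + 1"
  shows "of_nat (card (schubert_variety l m \<alpha> :: (nat \<Rightarrow> 'a::{field,finite}) set set)) =
      (\<Sum>s\<in>(\<Pi>\<^sub>E i\<in>{1..u}. {p i..\<alpha> (p i)}). \<Prod>i=0..u.
         schubert_lambda CARD('a) (int (\<alpha> (p i))) (int (\<alpha> (p (i + 1))))
           (int ((s(0 := 0, u + 1 := l)) i)) (int ((s(0 := 0, u + 1 := l)) (i + 1))))
    \<and> (\<forall>C :: 'a list set. is_schubert_code l m \<alpha> C \<longrightarrow>
         code_length C = card (schubert_variety l m \<alpha> :: (nat \<Rightarrow> 'a) set set))"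
proof
  \<comment> \<open>The convention \<open>\<alpha> 0 = 0\<close> extends monotonicity to index 0,
    where the chain of flag spaces starts.\<close>
  have mono: "mono_on {0..l} \<alpha>"
  proof (rule mono_onI)
    fix i j assume "i \<in> {0..l}" "j \<in> {0..l}" "i \<le> j"
    then show "\<alpha> i \<le> \<alpha> j"
      using assms(5) strict_mono_onD[OF assms(4), of i j] by (cases "i = 0 \<or> i = j") auto
  qed
  show "of_nat (card (schubert_variety l m \<alpha> :: (nat \<Rightarrow> 'a) set set)) =
      (\<Sum>s\<in>(\<Pi>\<^sub>E i\<in>{1..u}. {p i..\<alpha> (p i)}). \<Prod>i=0..u.
         schubert_lambda CARD('a) (int (\<alpha> (p i))) (int (\<alpha> (p (i + 1))))
           (int ((s(0 := 0, u + 1 := l)) i)) (int ((s(0 := 0, u + 1 := l)) (i + 1))))"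
    unfolding atLeast0AtMost Suc_eq_plus1[symmetric]
    by (rule card_schubert_variety) (use assms mono in auto)
  show "\<forall>C :: 'a list set. is_schubert_code l m \<alpha> C \<longrightarrow>
      code_length C = card (schubert_variety l m \<alpha> :: (nat \<Rightarrow> 'a) set set)"
  proof (intro allI impI)
    fix C :: "'a list set" assume "is_schubert_code l m \<alpha> C"
    then have "code_length C = card (pluecker l m ` (schubert_variety l m \<alpha> :: (nat \<Rightarrow> 'a) set set))"
      unfolding is_schubert_code_def by (rule code_length_is_code_of)
    \<comment> \<open>Distinct points of the Schubert variety have distinct Pluecker lines.\<close>
    also have "\<dots> = card (schubert_variety l m \<alpha> :: (nat \<Rightarrow> 'a) set set)"
      by (rule card_image, rule inj_on_subset[OF inj_on_pluecker]) (auto simp: schubert_variety_def)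
    finally show "code_length C = card (schubert_variety l m \<alpha> :: (nat \<Rightarrow> 'a) set set)" .
  qed
qed

end
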